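(* For every pair $(A,B) \in \{(36,30), (72,42), (196,70), (252,114)\}$ and every integer $n \geq 0$, we have $\nu_2(An+B) \equiv 0 \pmod{4}$.
   Context: For a positive integer $m$ and $k \geq 1$, $\nu_k(m)$ denotes the number of partitions of $m$ in which exactly $k$ distinct part sizes appear (e.g. $\nu_2(5)=5$, counting $4+1$, $3+2$, $3+1+1$, $2+2+1$, $2+1+1+1$). *)

theory Defs
  imports "HOL-Library.Multiset" "HOL-Number_Theory.Cong"
begin

text \<open>A partition of \<open>m\<close> is the multiset of its parts, which are positive.\<close>

definition partitions :: "nat \<Rightarrow> nat multiset set" where
  "partitions m = {P. 0 \<notin># P \<and> sum_mset P = m}"

definition nu :: "nat \<Rightarrow> nat \<Rightarrow> nat" where
  "nu k m = card {P \<in> partitions m. card (set_mset P) = k}"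

text \<open>Finiteness ensures that the cardinality in \<open>nu\<close> is a genuine count.\<close>

lemma size_le_sum_mset: "0 \<notin># P \<Longrightarrow> size P \<le> sum_mset (P :: nat multiset)"
  by (induction P) auto

lemma finite_partitions: "finite (partitions m)"
proof -
  have "partitions m \<subseteq> mset ` {xs. set xs \<subseteq> {..m} \<and> length xs \<le> m}"
  proof
    fix P assume "P \<in> partitions m"
    then have P: "0 \<notin># P" "sum_mset P = m" by (auto simp: partitions_def)
    obtain xs where xs: "mset xs = P" using ex_mset by blast
    have "length xs \<le> m" using size_le_sum_mset[OF P(1)] P(2) xs by auto
    moreover have "set xs \<subseteq> {..m}"
      using P(2) xs by (auto simp: sum_mset_sum_list member_le_sum_list)
    ultimately show "P \<in> mset ` {xs. set xs \<subseteq> {..m} \<and> length xs \<le> m}"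
      using xs by blast
  qed
  moreover have "finite {xs. set xs \<subseteq> {..m} \<and> length xs \<le> m}"
    by (rule finite_lists_length_le) simp
  ultimately show ?thesis by (meson finite_imageI finite_subset)
qed

end

theory Submission
  imports Defs "HOL-Computational_Algebra.Nth_Powers" "HOL-Number_Theory.Residues"
begin

text \<open>
  Write \<open>d\<close> and \<open>\<sigma>\<close> for the number and the sum of the divisors. Counting the solutions of
  \<open>a x + b y = n\<close> gives \<open>2 \<nu>\<^sub>2(n) = (\<Sum>k. d(k) d(n - k)) - \<sigma>(n) + d(n)\<close>. In all four progressions
  \<open>n = 2 q M\<close> with a prime \<open>q \<equiv> 3 (mod 4)\<close> not dividing the odd nonsquare \<open>M\<close>. Then \<open>8\<close> divides
  \<open>d(n)\<close> and \<open>\<sigma>(n)\<close>, and \<open>n\<close> is not a sum of two squares. Since \<open>d(k)\<close> is odd only for squares,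
  the convolution is \<open>2 (\<Sum>a. d(n - a\<^sup>2))\<close> modulo \<open>8\<close>, so the sum over \<open>a\<close> has to vanish
  modulo \<open>4\<close>. Let \<open>R\<close> count the positive solutions of \<open>2 a\<^sup>2 + 4 c\<^sup>2 = n\<close>. The even \<open>a\<close>
  contribute \<open>2 R\<close>, because \<open>d(n - a\<^sup>2) = 2 d((n - a\<^sup>2) / 2)\<close>. For odd \<open>a\<close>, Zagier's involution
  gives \<open>d(m) \<equiv> 2 #{(b, c). b\<^sup>2 + 4 c\<^sup>2 = m} (mod 4)\<close> for \<open>m = n - a\<^sup>2\<close>, and the symmetry between
  \<open>a\<close> and \<open>b\<close> in \<open>a\<^sup>2 + b\<^sup>2 + 4 c\<^sup>2 = n\<close> leaves \<open>2 R\<close> once more.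
\<close>

section \<open>Involutions\<close>

lemma card_involution:
  fixes key :: "'a \<Rightarrow> 'b :: linorder"
  assumes "finite A" and f: "\<And>x. x \<in> A \<Longrightarrow> f x \<in> A" "\<And>x. x \<in> A \<Longrightarrow> f (f x) = x"
  shows "card A = 2 * card {x \<in> A. key x < key (f x)} + card {x \<in> A. key x = key (f x)}"
proof -
  let ?less = "{x \<in> A. key x < key (f x)}" and ?greater = "{x \<in> A. key (f x) < key x}"
    and ?equal = "{x \<in> A. key x = key (f x)}"
  have "bij_betw f ?less ?greater"
    by (rule bij_betw_byWitness[where f' = f]) (use f in auto)
  then have "card ?less = card ?greater" by (rule bij_betw_same_card)
  moreover have "card A = card ?less + card ?greater + card ?equal"
  proof -
    have "card A = card (?less \<union> ?greater \<union> ?equal)" by (rule arg_cong[where f = card]) auto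
    also have "\<dots> = card (?less \<union> ?greater) + card ?equal"
      using \<open>finite A\<close> by (intro card_Un_disjoint) auto
    also have "card (?less \<union> ?greater) = card ?less + card ?greater"
      using \<open>finite A\<close> by (intro card_Un_disjoint) auto
    finally show ?thesis .
  qed
  ultimately show ?thesis by simp
qed

lemma even_card_symmetric_iff:
  fixes S :: "('a \<times> 'b :: linorder \<times> 'b) set"
  assumes "finite S" and "\<And>a b c. (a, b, c) \<in> S \<Longrightarrow> (a, c, b) \<in> S"
  shows "even (card S) \<longleftrightarrow> even (card {(a, b). (a, b, b) \<in> S})"
proof -
  let ?swap = "\<lambda>(a, b, c). (a, c, b)" and ?key = "\<lambda>(a, b, c). b"
  have "card S = 2 * card {t \<in> S. ?key t < ?key (?swap t)} + card {t \<in> S. ?key t = ?key (?swap t)}"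
    by (rule card_involution) (use assms in auto)
  also have "{t \<in> S. ?key t = ?key (?swap t)} = (\<lambda>(a, b). (a, b, b)) ` {(a, b). (a, b, b) \<in> S}"
    by force
  also have "card \<dots> = card {(a, b). (a, b, b) \<in> S}"
    by (rule card_image) (auto simp: inj_on_def)
  finally show ?thesis by simp
qed

section \<open>Residues of squares and products\<close>

lemma not_is_square_if_mod:
  fixes n k :: nat
  assumes "k > 0" and nonresidue: "n mod k \<notin> (\<lambda>r. r ^ 2 mod k) ` {0..<k}"
  shows "\<not> is_square n"
proof
  assume "is_square n"
  then obtain a where "n = a ^ 2" by (rule is_nth_powerE)
  then have "n mod k = (a mod k) ^ 2 mod k" by (simp add: power_mod)
  then have "n mod k \<in> (\<lambda>r. r ^ 2 mod k) ` {0..<k}"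
    using \<open>k > 0\<close> by (intro image_eqI[where x = "a mod k"]) simp_all
  with nonresidue show False by contradiction
qed

lemma card_square_roots: "card {a. a ^ 2 = n} = of_bool (is_square n)" for n :: nat
proof (cases "is_square n")
  case True
  then obtain a where "n = a ^ 2" by (rule is_nth_powerE)
  then have "{a. a ^ 2 = n} = {a}" by simp
  then show ?thesis using True by simp
next
  case False
  then have "{a. a ^ 2 = n} = {}" by (auto intro: is_nth_powerI)
  then show ?thesis using False by simp
qed

lemma power2_mod_4: "a ^ 2 mod 4 = of_bool (odd a)" for a :: nat
proof (cases "even a")
  case False
  then obtain b where "a = 2 * b + 1" by (rule oddE)
  then have "a ^ 2 = 1 + 4 * (b ^ 2 + b)" by (simp add: power2_eq_square algebra_simps)
  then show ?thesis using False by simp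
qed (auto elim!: evenE simp: power2_eq_square)

lemma cong_double_mod_4: "even x = even y \<Longrightarrow> [2 * x = 2 * y] (mod 4)" for x y :: nat
  unfolding cong_def by presburger

lemma mult_cong_mod_4:
  fixes x y :: nat
  assumes "even x \<or> even y"
  shows "[x * y = (if odd x then y else 0) + (if odd y then x else 0)] (mod 4)"
proof -
  have cong_even: "[a * b = b] (mod 4)" if "odd a" "even b" for a b :: nat
  proof -
    obtain i where "a = 2 * i + 1" using \<open>odd a\<close> by (rule oddE)
    moreover obtain j where "b = 2 * j" using \<open>even b\<close> by (rule evenE)
    ultimately have "a * b = b + 4 * (i * j)" by (simp add: algebra_simps)
    then show ?thesis by (simp add: cong_def)
  qed
  consider (odd_even) "odd x" "even y" | (even_odd) "even x" "odd y"
    | (both_even) "even x" "even y" using assms by blast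
  then show ?thesis
  proof cases
    case both_even
    then have "2 * 2 dvd x * y" by (intro mult_dvd_mono)
    then show ?thesis using both_even by (simp add: cong_0_iff)
  qed (use cong_even[of x y] cong_even[of y x] in \<open>auto simp: mult.commute\<close>)
qed

section \<open>Divisor functions\<close>

definition divisor_count :: "nat \<Rightarrow> nat" where
  "divisor_count n = card {d. d dvd n}"

definition divisor_sum :: "nat \<Rightarrow> nat" where
  "divisor_sum n = (\<Sum>d | d dvd n. d)"

definition divisor_convolution :: "nat \<Rightarrow> nat" where
  "divisor_convolution n = (\<Sum>k\<in>{1..<n}. divisor_count k * divisor_count (n - k))"

lemma bij_betw_divisors_coprime_mult:
  fixes m n :: nat
  assumes "coprime m n"
  shows "bij_betw (\<lambda>(a, b). a * b) ({a. a dvd m} \<times> {b. b dvd n}) {d. d dvd m * n}"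
proof (rule bij_betw_imageI)
  let ?pairs = "{a. a dvd m} \<times> {b. b dvd n}"
  show "inj_on (\<lambda>(a, b). a * b) ?pairs"
  proof (rule inj_on_inverseI[where g = "\<lambda>d. (gcd d m, gcd d n)"], clarify)
    fix a b assume "a dvd m" "b dvd n"
    then have "coprime n a" "coprime m b"
      using assms coprime_divisors[of n n a m] coprime_divisors[of m m b n] coprime_commute[of m n]
      by simp_all
    then show "gcd (a * b) m = a \<and> gcd (a * b) n = b"
      using \<open>a dvd m\<close> \<open>b dvd n\<close>
      by (simp add: gcd_mult_left_left_cancel gcd_mult_left_right_cancel gcd_nat.absorb1)
  qed
  show "(\<lambda>(a, b). a * b) ` ?pairs = {d. d dvd m * n}"
  proof (intro equalityI subsetI)
    fix d assume "d \<in> {d. d dvd m * n}"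
    then obtain a b where "d = a * b" "a dvd m" "b dvd n" using division_decomp by blast
    then show "d \<in> (\<lambda>(a, b). a * b) ` ?pairs" by auto
  qed (auto intro: mult_dvd_mono)
qed

lemma divisor_count_coprime_mult:
  "coprime m n \<Longrightarrow> divisor_count (m * n) = divisor_count m * divisor_count n"
  using bij_betw_same_card[OF bij_betw_divisors_coprime_mult]
  by (simp add: divisor_count_def card_cartesian_product)

lemma divisor_sum_coprime_mult:
  assumes "coprime m n"
  shows "divisor_sum (m * n) = divisor_sum m * divisor_sum n"
proof -
  have "divisor_sum (m * n) = (\<Sum>(a, b)\<in>{a. a dvd m} \<times> {b. b dvd n}. a * b)"
    unfolding divisor_sum_def
    using sum.reindex_bij_betw[OF bij_betw_divisors_coprime_mult[OF assms], of "\<lambda>d. d"]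
    by (simp add: case_prod_unfold)
  also have "\<dots> = divisor_sum m * divisor_sum n"
    by (simp add: divisor_sum_def sum_product sum.cartesian_product)
  finally show ?thesis .
qed

lemma divisors_prime: "prime p \<Longrightarrow> {d. d dvd p} = {1, p}" for p :: nat
  by (auto simp: prime_nat_iff)

lemma divisor_count_prime: "prime p \<Longrightarrow> divisor_count p = 2"
  by (simp add: divisor_count_def divisors_prime prime_gt_1_nat less_imp_neq flip: One_nat_def)

lemma divisor_sum_prime: "prime p \<Longrightarrow> divisor_sum p = p + 1"
  by (simp add: divisor_sum_def divisors_prime prime_gt_1_nat less_imp_neq flip: One_nat_def)

lemma divisor_count_eq:
  assumes "m > 0"
  shows "divisor_count m = 2 * card {d. d dvd m \<and> d * d < m} + of_bool (is_square m)"
proof -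
  have "d < m div d \<longleftrightarrow> d * d < m" "d = m div d \<longleftrightarrow> d ^ 2 = m" if "d dvd m" for d
    using that assms by (auto simp: power2_eq_square)
  then have below: "{d \<in> {d. d dvd m}. d < m div d} = {d. d dvd m \<and> d * d < m}"
    and root: "{d \<in> {d. d dvd m}. d = m div d} = {d. d ^ 2 = m}"
    by auto
  have "card {d. d ^ 2 = m} = of_bool (is_square m)" by (rule card_square_roots)
  moreover have "divisor_count m = 2 * card {d \<in> {d. d dvd m}. d < m div d}
      + card {d \<in> {d. d dvd m}. d = m div d}"
    unfolding divisor_count_def
    by (rule card_involution[where key = "\<lambda>d. d"]) (use assms in auto)
  ultimately show ?thesis unfolding below root by simp
qed

lemma even_divisor_count_iff: "m > 0 \<Longrightarrow> even (divisor_count m) \<longleftrightarrow> \<not> is_square m"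
  by (simp add: divisor_count_eq)

lemma even_divisor_sum_iff:
  assumes "odd m"
  shows "even (divisor_sum m) \<longleftrightarrow> even (divisor_count m)"
proof -
  have "{d \<in> {d. d dvd m}. odd d} = {d. d dvd m}" using assms dvd_trans by blast
  moreover have "finite {d. d dvd m}" using odd_pos[OF assms] by simp
  ultimately show ?thesis unfolding divisor_sum_def divisor_count_def by (simp add: even_sum_iff)
qed

lemma divisor_count_double_odd_cong:
  assumes "odd m"
  shows "[divisor_count (2 * m) = 2 * of_bool (is_square m)] (mod 4)"
proof -
  have "divisor_count (2 * m) = 2 * divisor_count m"
    using assms by (simp add: divisor_count_coprime_mult divisor_count_prime)
  then show ?thesis
    using even_divisor_count_iff[of m] assms
    by (simp only:) (rule cong_double_mod_4, auto intro: odd_pos)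
qed

section \<open>Zagier's involution\<close>

definition zagier_set :: "nat \<Rightarrow> (nat \<times> nat \<times> nat) set" where
  "zagier_set m = {(x, y, z). 0 < x \<and> 0 < y \<and> 0 < z \<and> x ^ 2 + 4 * y * z = m}"

fun zagier_map :: "nat \<times> nat \<times> nat \<Rightarrow> nat \<times> nat \<times> nat" where
  "zagier_map (x, y, z) =
    (if x + z < y then (x + 2 * z, z, y - x - z)
     else if x < 2 * y then (2 * y - x, y, x + z - y)
     else (x - 2 * y, x + z - y, y))"

lemma finite_zagier_set: "finite (zagier_set m)"
proof (rule finite_subset)
  show "zagier_set m \<subseteq> {..m} \<times> {..m} \<times> {..m}"
  proof (clarsimp simp: zagier_set_def)
    fix x y z :: nat assume "0 < x" "0 < y" "0 < z"
    then have "x \<le> x ^ 2" "y \<le> y * z" "z \<le> y * z" by (auto simp: power2_eq_square)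
    then show "x \<le> x ^ 2 + 4 * y * z \<and> y \<le> x ^ 2 + 4 * y * z \<and> z \<le> x ^ 2 + 4 * y * z"
      by linarith
  qed
qed auto

lemma zagier_set_cases:
  assumes "odd m" "\<not> is_square m" "(x, y, z) \<in> zagier_set m"
  obtains (left) v where "y = x + z + v" "0 < v"
  | (middle) u v where "2 * y = x + u" "x + z = y + v" "0 < u" "0 < v"
  | (right) u where "x = 2 * y + u" "0 < u"
proof -
  have m: "x ^ 2 + 4 * y * z = m" using assms(3) by (simp add: zagier_set_def)
  have "y \<noteq> x + z"
  proof
    assume "y = x + z"
    then have "m = (y + z) ^ 2" using m by (simp add: power2_eq_square algebra_simps)
    then show False using assms(2) by simp
  qed
  moreover have "x \<noteq> 2 * y" using m \<open>odd m\<close> by auto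
  ultimately consider "x + z < y" | "x < 2 * y" "y < x + z" | "2 * y < x" by linarith
  then show thesis by cases (metis less_imp_add_positive left middle right)+
qed

lemma zagier_form_middle:
  fixes x y z u v :: nat
  assumes "2 * y = x + u" "x + z = y + v"
  shows "u ^ 2 + 4 * y * v = x ^ 2 + 4 * y * z"
proof -
  have uv: "int u = 2 * int y - int x" "int v = int x + int z - int y" using assms by linarith+
  have "int (u ^ 2 + 4 * y * v) = int (x ^ 2 + 4 * y * z)"
    by (simp add: uv power2_eq_square algebra_simps)
  then show ?thesis by (simp only: of_nat_eq_iff)
qed

lemma zagier_map_in_zagier_set:
  assumes "odd m" "\<not> is_square m" "(x, y, z) \<in> zagier_set m"
  shows "zagier_map (x, y, z) \<in> zagier_set m"
  using assms
proof (cases rule: zagier_set_cases)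
  case (left v)
  then have "(x + 2 * z) ^ 2 + 4 * z * v = x ^ 2 + 4 * y * z"
    by (simp add: power2_eq_square algebra_simps)
  then show ?thesis using left assms(3) by (simp add: zagier_set_def)
next
  case (middle u v)
  then have "zagier_map (x, y, z) = (u, y, v)" by auto
  then show ?thesis
    using zagier_form_middle[OF middle(1,2)] middle assms(3) by (simp add: zagier_set_def)
next
  case (right u)
  then have "u ^ 2 + 4 * (u + y + z) * y = x ^ 2 + 4 * y * z"
    by (simp add: power2_eq_square algebra_simps)
  then show ?thesis using right assms(3) by (simp add: zagier_set_def ac_simps)
qed

lemma zagier_map_involution:
  assumes "odd m" "\<not> is_square m" "(x, y, z) \<in> zagier_set m"
  shows "zagier_map (zagier_map (x, y, z)) = (x, y, z)"
proof -
  have "0 < x" "0 < y" "0 < z" using assms(3) by (simp_all add: zagier_set_def)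
  with assms show ?thesis by (cases rule: zagier_set_cases) auto
qed

lemma fst_zagier_map_eq_iff:
  assumes "odd m" "\<not> is_square m" "(x, y, z) \<in> zagier_set m"
  shows "x = fst (zagier_map (x, y, z)) \<longleftrightarrow> x = y"
proof -
  have "0 < x" "0 < y" "0 < z" using assms(3) by (simp_all add: zagier_set_def)
  with assms show ?thesis by (cases rule: zagier_set_cases) auto
qed

lemma card_zagier_set_diagonal:
  assumes "m mod 4 = 1"
  shows "card {(x, y, z) \<in> zagier_set m. x = y} = card {d. d dvd m \<and> d * d < m}"
proof (rule bij_betw_same_card[OF bij_betw_imageI])
  let ?diagonal = "{(x, y, z) \<in> zagier_set m. x = y}"
  show "inj_on fst ?diagonal" by (auto simp: inj_on_def zagier_set_def)
  show "fst ` ?diagonal = {d. d dvd m \<and> d * d < m}"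
  proof (intro equalityI subsetI)
    fix d assume "d \<in> fst ` ?diagonal"
    then obtain z where "0 < d" "0 < z" "m = d * (d + 4 * z)"
      by (auto simp: zagier_set_def power2_eq_square algebra_simps)
    then show "d \<in> {d. d dvd m \<and> d * d < m}" by auto
  next
    fix d assume "d \<in> {d. d dvd m \<and> d * d < m}"
    then obtain e where e: "m = d * e" "d * d < d * e" by auto
    then have d: "d < e" "d > 0" by auto
    have "(d mod 4) * (e mod 4) mod 4 = 1" using e assms by (simp add: mod_mult_eq)
    moreover have "d mod 4 \<in> {0, 1, 2, 3}" "e mod 4 \<in> {0, 1, 2, 3}" by auto
    ultimately have "e mod 4 = d mod 4" by auto
    then have "4 dvd e - d" using d by (simp add: mod_eq_dvd_iff_nat)
    then obtain z where "e = d + 4 * z" using d by (metis dvdE le_add_diff_inverse less_imp_le)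
    then have "(d, d, z) \<in> ?diagonal"
      using d e by (auto simp: zagier_set_def power2_eq_square algebra_simps)
    then show "d \<in> fst ` ?diagonal" by (rule rev_image_eqI) simp
  qed
qed

lemma even_card_zagier_set_iff:
  assumes "odd m" "\<not> is_square m"
  shows "even (card (zagier_set m)) \<longleftrightarrow> even (card {(x, y, z) \<in> zagier_set m. x = y})"
proof -
  have "card (zagier_set m) = 2 * card {t \<in> zagier_set m. fst t < fst (zagier_map t)}
      + card {t \<in> zagier_set m. fst t = fst (zagier_map t)}"
    by (rule card_involution[OF finite_zagier_set])
      (metis prod_cases3 zagier_map_in_zagier_set[OF assms] zagier_map_involution[OF assms])+
  also have "{t \<in> zagier_set m. fst t = fst (zagier_map t)} = {(x, y, z) \<in> zagier_set m. x = y}"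
    using fst_zagier_map_eq_iff[OF assms] by (auto simp del: zagier_map.simps)
  finally show ?thesis by simp
qed

definition square_reps :: "nat \<Rightarrow> nat \<Rightarrow> nat \<Rightarrow> (nat \<times> nat) set" where
  "square_reps k l n = {(x, y). 0 < x \<and> 0 < y \<and> k * x ^ 2 + l * y ^ 2 = n}"

lemma finite_square_reps:
  assumes "0 < k" "0 < l"
  shows "finite (square_reps k l n)"
proof (rule finite_subset)
  have "x \<le> i * x ^ 2" if "0 < i" for i x :: nat
    using mult_le_mono[of 1 i x "x ^ 2"] that by (simp add: power2_eq_square)
  then show "square_reps k l n \<subseteq> {..n} \<times> {..n}"
    using assms by (auto simp: square_reps_def intro: trans_le_add1 trans_le_add2)
qed simp

text \<open>Interchanging \<open>y\<close> and \<open>z\<close> is a second involution of the same set, with fixed points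
  the representations of \<open>m\<close> by \<open>x\<^sup>2 + 4 y\<^sup>2\<close>.\<close>

lemma divisor_count_cong_card_square_reps:
  assumes "m mod 4 = 1" "\<not> is_square m"
  shows "[divisor_count m = 2 * card (square_reps 1 4 m)] (mod 4)"
proof -
  have "odd m" "m > 0" using assms(1) by presburger+
  have "divisor_count m = 2 * card {(x, y, z) \<in> zagier_set m. x = y}"
    using divisor_count_eq[OF \<open>m > 0\<close>] assms by (simp add: card_zagier_set_diagonal)
  moreover have "{(x, y). (x, y, y) \<in> zagier_set m} = square_reps 1 4 m"
    by (auto simp: zagier_set_def square_reps_def power2_eq_square)
  then have "even (card (zagier_set m)) \<longleftrightarrow> even (card (square_reps 1 4 m))"
    by (subst even_card_symmetric_iff[OF finite_zagier_set])
      (auto simp: zagier_set_def algebra_simps)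
  then have "even (card {(x, y, z) \<in> zagier_set m. x = y}) \<longleftrightarrow> even (card (square_reps 1 4 m))"
    using even_card_zagier_set_iff[OF \<open>odd m\<close> assms(2)] by simp
  ultimately show ?thesis by (simp only: cong_double_mod_4)
qed

section \<open>The divisor count at the numbers \<open>n - a\<^sup>2\<close>\<close>

definition is_sum_two_squares :: "nat \<Rightarrow> bool" where
  "is_sum_two_squares n \<longleftrightarrow> (\<exists>a b. n = a ^ 2 + b ^ 2)"

definition odd_ternary_reps :: "nat \<Rightarrow> (nat \<times> nat \<times> nat) set" where
  "odd_ternary_reps n =
    {(c, a, b). 0 < c \<and> odd a \<and> odd b \<and> a ^ 2 + b ^ 2 + 4 * c ^ 2 = n}"

lemma is_sum_two_squares_if_squares:
  assumes "k \<le> n" "is_square k" "is_square (n - k)"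
  shows "is_sum_two_squares n"
proof -
  obtain a b where "k = a ^ 2" "n - k = b ^ 2" using assms(2,3) by (auto elim!: is_nth_powerE)
  then have "n = a ^ 2 + b ^ 2" using assms(1) by linarith
  then show ?thesis by (auto simp: is_sum_two_squares_def)
qed

lemma finite_power2_less: "finite {a :: nat. a ^ 2 < n}"
  by (rule finite_subset[of _ "{..n}"])
    (auto simp: power2_eq_square intro: order_trans[OF le_square])

lemma bij_betw_odd_ternary_reps:
  assumes n: "n mod 4 = 2"
  shows "bij_betw (\<lambda>(a, b, c). (c, a, b))
    (SIGMA a:{a. odd a \<and> a ^ 2 < n}. square_reps 1 4 (n - a ^ 2)) (odd_ternary_reps n)"
proof (rule bij_betw_byWitness[where f' = "\<lambda>(c, a, b). (a, b, c)"])
  let ?S = "SIGMA a:{a. odd a \<and> a ^ 2 < n}. square_reps 1 4 (n - a ^ 2)"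
  show "(\<lambda>(a, b, c). (c, a, b)) ` ?S \<subseteq> odd_ternary_reps n"
  proof clarify
    fix a b c assume "odd a" "a ^ 2 < n" "(b, c) \<in> square_reps 1 4 (n - a ^ 2)"
    then have eq: "a ^ 2 + b ^ 2 + 4 * c ^ 2 = n" and "0 < c" by (auto simp: square_reps_def)
    have "(a ^ 2 mod 4 + b ^ 2 mod 4) mod 4 = 2"
      using n by (simp add: mod_simps flip: eq)
    then have "odd b" using \<open>odd a\<close> by (auto simp: power2_mod_4)
    then show "(c, a, b) \<in> odd_ternary_reps n"
      using eq \<open>0 < c\<close> \<open>odd a\<close> by (simp add: odd_ternary_reps_def)
  qed
  show "(\<lambda>(c, a, b). (a, b, c)) ` odd_ternary_reps n \<subseteq> ?S"
    by (auto simp: odd_ternary_reps_def square_reps_def odd_pos)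
qed auto

lemma even_card_odd_ternary_reps_iff:
  assumes n: "n mod 4 = 2"
  shows "even (card (odd_ternary_reps n)) \<longleftrightarrow> even (card (square_reps 2 4 n))"
proof -
  have "finite (SIGMA a:{a. odd a \<and> a ^ 2 < n}. square_reps 1 4 (n - a ^ 2))"
    by (intro finite_SigmaI finite_square_reps finite_subset[OF _ finite_power2_less[of n]]) auto
  then have fin: "finite (odd_ternary_reps n)"
    using bij_betw_finite[OF bij_betw_odd_ternary_reps[OF n]] by simp
  have odd: "odd a" if eq: "n = 2 * a ^ 2 + 4 * c ^ 2" for a c
  proof
    assume "even a"
    then have "4 dvd a ^ 2" by (auto elim: evenE simp: power2_eq_square)
    then have "4 dvd n" by (simp add: eq)
    with n show False by simp
  qed
  have "bij_betw prod.swap {(c, a). (c, a, a) \<in> odd_ternary_reps n} (square_reps 2 4 n)"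
    by (rule bij_betw_byWitness[where f' = prod.swap])
      (auto simp: odd_ternary_reps_def square_reps_def odd_pos dest: odd)
  then have "card {(c, a). (c, a, a) \<in> odd_ternary_reps n} = card (square_reps 2 4 n)"
    by (rule bij_betw_same_card)
  moreover have "even (card (odd_ternary_reps n)) \<longleftrightarrow>
      even (card {(c, a). (c, a, a) \<in> odd_ternary_reps n})"
    by (rule even_card_symmetric_iff[OF fin]) (auto simp: odd_ternary_reps_def)
  ultimately show ?thesis by simp
qed

lemma sum_divisor_count_minus_odd_square_cong:
  assumes n: "n mod 4 = 2" and nonrep: "\<not> is_sum_two_squares n"
  shows "[(\<Sum>a | odd a \<and> a ^ 2 < n. divisor_count (n - a ^ 2)) =
    2 * card (square_reps 2 4 n)] (mod 4)"
proof -
  let ?A = "{a. odd a \<and> a ^ 2 < n}"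
  have "[(\<Sum>a\<in>?A. divisor_count (n - a ^ 2)) =
      (\<Sum>a\<in>?A. 2 * card (square_reps 1 4 (n - a ^ 2)))] (mod 4)"
  proof (intro cong_sum divisor_count_cong_card_square_reps)
    fix a assume a: "a \<in> ?A"
    then obtain m where m: "n = a ^ 2 + m" using less_imp_add_positive by blast
    have "a ^ 2 mod 4 = 1" using a by (simp add: power2_mod_4)
    then have "m mod 4 = 1" using n unfolding m by presburger
    then show "(n - a ^ 2) mod 4 = 1" by (simp add: m)
    show "\<not> is_square (n - a ^ 2)"
      using a nonrep is_sum_two_squares_if_squares[of "a ^ 2" n] by auto
  qed
  also have "(\<Sum>a\<in>?A. 2 * card (square_reps 1 4 (n - a ^ 2))) =
      2 * card (SIGMA a:?A. square_reps 1 4 (n - a ^ 2))"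
    using finite_subset[OF _ finite_power2_less[of n], of ?A]
    by (simp add: finite_square_reps sum_distrib_left subset_eq)
  also have "\<dots> = 2 * card (odd_ternary_reps n)"
    using bij_betw_same_card[OF bij_betw_odd_ternary_reps[OF n]] by simp
  also have "[2 * card (odd_ternary_reps n) = 2 * card (square_reps 2 4 n)] (mod 4)"
    using even_card_odd_ternary_reps_iff[OF n] by (rule cong_double_mod_4)
  finally show ?thesis .
qed

lemma bij_betw_square_reps_even_roots:
  assumes n: "n mod 4 = 2"
  shows "bij_betw (\<lambda>(x, y). 2 * y) (square_reps 2 4 n)
    {a. even a \<and> 0 < a \<and> a ^ 2 < n \<and> is_square ((n - a ^ 2) div 2)}" (is "bij_betw _ _ ?A")
proof (rule bij_betw_imageI)
  show "inj_on (\<lambda>(x, y). 2 * y) (square_reps 2 4 n)"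
    by (auto simp: inj_on_def square_reps_def)
  show "(\<lambda>(x, y). 2 * y) ` square_reps 2 4 n = ?A"
  proof (intro equalityI subsetI)
    fix a assume "a \<in> (\<lambda>(x, y). 2 * y) ` square_reps 2 4 n"
    then show "a \<in> ?A"
      by (auto simp: square_reps_def power_mult_distrib)
  next
    fix a assume a: "a \<in> ?A"
    then obtain y where y: "a = 2 * y" by (auto elim: evenE)
    obtain x where x: "(n - a ^ 2) div 2 = x ^ 2" using a by (auto elim: is_nth_powerE)
    have "a ^ 2 = 4 * y ^ 2" using y by (simp add: power_mult_distrib)
    then have "2 * x ^ 2 + 4 * y ^ 2 = n" "n \<noteq> 4 * y ^ 2" using a x n by auto presburger+
    moreover from this have "x > 0" by (cases x) auto
    ultimately have "(x, y) \<in> square_reps 2 4 n" using a y by (simp add: square_reps_def)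
    then show "a \<in> (\<lambda>(x, y). 2 * y) ` square_reps 2 4 n" using y by force
  qed
qed

lemma sum_divisor_count_minus_even_square_cong:
  assumes n: "n mod 4 = 2"
  shows "[(\<Sum>a | even a \<and> 0 < a \<and> a ^ 2 < n. divisor_count (n - a ^ 2)) =
    2 * card (square_reps 2 4 n)] (mod 4)"
proof -
  let ?A = "{a. even a \<and> 0 < a \<and> a ^ 2 < n}"
  let ?half = "\<lambda>a. (n - a ^ 2) div 2"
  have "[(\<Sum>a\<in>?A. divisor_count (n - a ^ 2)) =
      (\<Sum>a\<in>?A. 2 * of_bool (is_square (?half a)))] (mod 4)"
  proof (intro cong_sum)
    fix a assume "a \<in> ?A"
    then have "a ^ 2 mod 4 = 0" "a ^ 2 < n" by (simp_all add: power2_mod_4)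
    then have "n - a ^ 2 = 2 * ?half a" "odd (?half a)" using n by presburger+
    then show "[divisor_count (n - a ^ 2) = 2 * of_bool (is_square (?half a))] (mod 4)"
      using divisor_count_double_odd_cong by metis
  qed
  also have "(\<Sum>a\<in>?A. 2 * of_bool (is_square (?half a))) = 2 * card {a \<in> ?A. is_square (?half a)}"
    using finite_subset[OF _ finite_power2_less[of n], of ?A]
    by (simp add: subset_eq Int_def flip: sum_distrib_left)
  also have "card {a \<in> ?A. is_square (?half a)} = card (square_reps 2 4 n)"
    using bij_betw_same_card[OF bij_betw_square_reps_even_roots[OF n]] by simp
  finally show ?thesis .
qed

lemma four_dvd_sum_divisor_count_minus_square:
  assumes "n mod 4 = 2" "\<not> is_sum_two_squares n"
  shows "4 dvd (\<Sum>a | 0 < a \<and> a ^ 2 < n. divisor_count (n - a ^ 2))"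
proof -
  have "{a. 0 < a \<and> a ^ 2 < n} =
      {a. odd a \<and> a ^ 2 < n} \<union> {a. even a \<and> 0 < a \<and> a ^ 2 < n}"
    by (auto intro: odd_pos)
  then have "(\<Sum>a | 0 < a \<and> a ^ 2 < n. divisor_count (n - a ^ 2)) =
      (\<Sum>a | odd a \<and> a ^ 2 < n. divisor_count (n - a ^ 2)) +
      (\<Sum>a | even a \<and> 0 < a \<and> a ^ 2 < n. divisor_count (n - a ^ 2))"
    by (simp only:, intro sum.union_disjoint finite_subset[OF _ finite_power2_less[of n]]) auto
  moreover have "[\<dots> = 2 * card (square_reps 2 4 n) + 2 * card (square_reps 2 4 n)] (mod 4)"
    using assms
    by (intro cong_add sum_divisor_count_minus_odd_square_cong
        sum_divisor_count_minus_even_square_cong)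
  ultimately show ?thesis by (simp add: cong_def mod_eq_0_iff_dvd)
qed

section \<open>The divisor convolution\<close>

lemma sum_fold_middle:
  fixes h :: "nat \<Rightarrow> 'a :: comm_monoid_add"
  assumes "N > 0"
  shows "(\<Sum>k\<in>{1..<2 * N}. h k) = (\<Sum>k\<in>{1..<N}. h k + h (2 * N - k)) + h N"
proof -
  have "{1..<2 * N} = {1..<N} \<union> insert N {N<..<2 * N}" using assms by auto
  then have "(\<Sum>k\<in>{1..<2 * N}. h k) = (\<Sum>k\<in>{1..<N}. h k) + (\<Sum>k\<in>insert N {N<..<2 * N}. h k)"
    by (simp only:, intro sum.union_disjoint) auto
  moreover have "(\<Sum>k\<in>{N<..<2 * N}. h k) = (\<Sum>k\<in>{1..<N}. h (2 * N - k))"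
    by (rule sum.reindex_bij_witness[of _ "\<lambda>k. 2 * N - k" "\<lambda>k. 2 * N - k"]) auto
  ultimately show ?thesis by (simp add: sum.distrib ac_simps)
qed

lemma sum_over_squares:
  fixes h :: "nat \<Rightarrow> 'a :: comm_monoid_add"
  shows "(\<Sum>k\<in>{1..<n}. if is_square k then h k else 0) = (\<Sum>a | 0 < a \<and> a ^ 2 < n. h (a ^ 2))"
proof -
  have "{k \<in> {1..<n}. is_square k} = (\<lambda>a. a ^ 2) ` {a. 0 < a \<and> a ^ 2 < n}"
    by (auto elim!: is_nth_powerE intro!: imageI gr0I)
  moreover have "inj_on (\<lambda>a :: nat. a ^ 2) {a. 0 < a \<and> a ^ 2 < n}"
    by (auto simp: inj_on_def)
  ultimately show ?thesis by (simp add: sum.reindex flip: sum.inter_filter)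
qed

lemma half_divisor_convolution_cong:
  assumes nonrep: "\<not> is_sum_two_squares (2 * N)"
  shows "[(\<Sum>k\<in>{1..<N}. divisor_count k * divisor_count (2 * N - k)) =
    (\<Sum>a | 0 < a \<and> a ^ 2 < 2 * N. divisor_count (2 * N - a ^ 2))] (mod 4)"
proof -
  let ?g = "\<lambda>k. if is_square k then divisor_count (2 * N - k) else 0"
  have not_both: "\<not> is_square k \<or> \<not> is_square (2 * N - k)" if "k \<le> 2 * N" for k
    using that nonrep is_sum_two_squares_if_squares by blast
  have "N > 0" using not_both[of 0] by (cases N) auto
  have "[(\<Sum>k\<in>{1..<N}. divisor_count k * divisor_count (2 * N - k)) =
      (\<Sum>k\<in>{1..<N}. ?g k + ?g (2 * N - k))] (mod 4)"
  proof (intro cong_sum)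
    fix k assume "k \<in> {1..<N}"
    then have parity: "odd (divisor_count k) \<longleftrightarrow> is_square k"
      "odd (divisor_count (2 * N - k)) \<longleftrightarrow> is_square (2 * N - k)"
      and reflect: "2 * N - (2 * N - k) = k" and "k \<le> 2 * N"
      using even_divisor_count_iff by simp_all
    then have "even (divisor_count k) \<or> even (divisor_count (2 * N - k))"
      using not_both[of k] by blast
    from mult_cong_mod_4[OF this]
    show "[divisor_count k * divisor_count (2 * N - k) = ?g k + ?g (2 * N - k)] (mod 4)"
      unfolding parity reflect .
  qed
  also have "(\<Sum>k\<in>{1..<N}. ?g k + ?g (2 * N - k)) = (\<Sum>k\<in>{1..<2 * N}. ?g k)"
    using sum_fold_middle[OF \<open>N > 0\<close>, of ?g] not_both[of N] by simp
  also have "\<dots> = (\<Sum>a | 0 < a \<and> a ^ 2 < 2 * N. divisor_count (2 * N - a ^ 2))"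
    by (rule sum_over_squares)
  finally show ?thesis .
qed

lemma divisor_convolution_cong:
  assumes nonrep: "\<not> is_sum_two_squares (2 * N)"
  shows "[divisor_convolution (2 * N) =
    2 * (\<Sum>a | 0 < a \<and> a ^ 2 < 2 * N. divisor_count (2 * N - a ^ 2)) + divisor_count N ^ 2] (mod 8)"
proof -
  let ?half = "\<Sum>k\<in>{1..<N}. divisor_count k * divisor_count (2 * N - k)"
  have "N > 0" using nonrep by (cases N) (auto simp: is_sum_two_squares_def)
  then have "divisor_convolution (2 * N) = 2 * ?half + divisor_count N ^ 2"
    unfolding divisor_convolution_def sum_distrib_left
    by (subst sum_fold_middle) (auto simp: power2_eq_square mult.commute intro!: sum.cong)
  moreover have "[2 * ?half =
      2 * (\<Sum>a | 0 < a \<and> a ^ 2 < 2 * N. divisor_count (2 * N - a ^ 2))] (mod 8)"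
    using cong_cmult_leftI[OF half_divisor_convolution_cong[OF nonrep], of 2] by simp
  ultimately show ?thesis by (simp add: cong_add)
qed

lemma eight_dvd_divisor_convolution:
  assumes "odd N" and nonrep: "\<not> is_sum_two_squares (2 * N)" and "4 dvd divisor_count N"
  shows "8 dvd divisor_convolution (2 * N)"
proof -
  have "2 * N mod 4 = 2" using assms(1) by presburger
  then have "2 * 4 dvd 2 * (\<Sum>a | 0 < a \<and> a ^ 2 < 2 * N. divisor_count (2 * N - a ^ 2))"
    using nonrep by (intro mult_dvd_mono four_dvd_sum_divisor_count_minus_square) auto
  moreover have "8 dvd divisor_count N ^ 2"
    using dvd_power_same[OF assms(3), of 2] by (auto intro: dvd_trans[of 8 16])
  ultimately show ?thesis
    using cong_dvd_iff[OF divisor_convolution_cong[OF nonrep]] by simp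
qed

section \<open>Partitions with two part sizes\<close>

definition linear_solutions :: "nat \<Rightarrow> (nat \<times> nat \<times> nat \<times> nat) set" where
  "linear_solutions n = {(a, x, b, y). 0 < a \<and> 0 < x \<and> 0 < b \<and> 0 < y \<and> a * x + b * y = n}"

definition two_part_mset :: "nat \<times> nat \<times> nat \<times> nat \<Rightarrow> nat multiset" where
  "two_part_mset = (\<lambda>(a, x, b, y). replicate_mset x a + replicate_mset y b)"

lemma finite_linear_solutions: "finite (linear_solutions n)"
proof (rule finite_subset)
  show "linear_solutions n \<subseteq> {..n} \<times> {..n} \<times> {..n} \<times> {..n}"
  proof (clarsimp simp: linear_solutions_def)
    fix a x b y :: nat assume "0 < a" "0 < x" "0 < b" "0 < y"
    then have "a \<le> a * x" "x \<le> a * x" "b \<le> b * y" "y \<le> b * y" by auto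
    then show "a \<le> a * x + b * y \<and> x \<le> a * x + b * y \<and> b \<le> a * x + b * y \<and> y \<le> a * x + b * y"
      by linarith
  qed
qed auto

lemma inj_on_two_part_mset: "inj_on two_part_mset {(a, x, b, y) \<in> linear_solutions n. b < a}"
proof (rule inj_onI)
  let ?S = "{(a, x, b, y) \<in> linear_solutions n. b < a}"
  fix s t assume st: "s \<in> ?S" "t \<in> ?S" and eq: "two_part_mset s = two_part_mset t"
  obtain a x b y where s: "s = (a, x, b, y)" by (cases s)
  obtain a' x' b' y' where t: "t = (a', x', b', y')" by (cases t)
  have pos: "0 < x" "0 < y" "0 < x'" "0 < y'" and less: "b < a" "b' < a'"
    using st by (simp_all add: s t linear_solutions_def)
  have "{a, b} = {a', b'}"
    using arg_cong[OF eq, of set_mset] pos by (auto simp: s t two_part_mset_def)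
  then have ab: "a = a'" "b = b'" using less by (auto simp: doubleton_eq_iff)
  have "count (two_part_mset s) c = count (two_part_mset t) c" for c
    using eq by simp
  from this[of a] this[of b] show "s = t"
    using ab less by (simp add: s t two_part_mset_def)
qed

lemma image_two_part_mset:
  "two_part_mset ` {(a, x, b, y) \<in> linear_solutions n. b < a} =
    {P \<in> partitions n. card (set_mset P) = 2}" (is "_ ` ?S = ?T")
proof (intro equalityI subsetI)
  fix P assume "P \<in> two_part_mset ` ?S"
  then show "P \<in> ?T"
    by (auto simp: linear_solutions_def two_part_mset_def partitions_def mult.commute)
next
  fix P assume "P \<in> ?T"
  then have P: "0 \<notin># P" "sum_mset P = n" "card (set_mset P) = 2"
    by (auto simp: partitions_def)
  from P(3) obtain u v where "set_mset P = {u, v}" "u \<noteq> v"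
    by (auto simp: card_2_iff)
  then obtain a b where ab: "set_mset P = {a, b}" "b < a"
    by (metis insert_commute linorder_neqE_nat)
  define t where "t = (a, count P a, b, count P b)"
  have eq: "P = two_part_mset t"
    using ab unfolding t_def two_part_mset_def
    by (intro multiset_eqI) (auto simp: count_eq_zero_iff)
  have "a * count P a + b * count P b = n"
    using P(2) by (subst (asm) eq) (simp add: t_def two_part_mset_def mult.commute)
  moreover have "0 < count P a" "0 < count P b" using ab by auto
  moreover have "0 < b" using P(1) ab by (cases b) auto
  ultimately have "t \<in> ?S" using ab by (simp add: t_def linear_solutions_def)
  then show "P \<in> two_part_mset ` ?S" using eq by (rule rev_image_eqI)
qed

lemma nu_2_eq_card: "nu 2 n = card {(a, x, b, y) \<in> linear_solutions n. b < a}"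
  unfolding nu_def image_two_part_mset[symmetric]
  by (rule card_image[OF inj_on_two_part_mset])

lemma card_linear_solutions: "card (linear_solutions n) = divisor_convolution n"
proof -
  let ?S = "SIGMA k:{1..<n}. {d. d dvd k} \<times> {d. d dvd (n - k)}"
  have "bij_betw (\<lambda>(k, a, b). (a, k div a, b, (n - k) div b)) ?S (linear_solutions n)"
  proof (rule bij_betw_byWitness[where f' = "\<lambda>(a, x, b, y). (a * x, a, b)"])
    have pos: "0 < d" "0 < k div d" if "d dvd k" "0 < k" for d k :: nat
      using that by auto
    show "(\<lambda>(k, a, b). (a, k div a, b, (n - k) div b)) ` ?S \<subseteq> linear_solutions n"
      by (auto simp: linear_solutions_def pos)
  qed (auto simp: linear_solutions_def)
  then have "card (linear_solutions n) = card ?S" by (rule bij_betw_same_card[symmetric])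
  also have "\<dots> = (\<Sum>k\<in>{1..<n}. card ({d. d dvd k} \<times> {d. d dvd (n - k)}))"
    by (rule card_SigmaI) auto
  finally show ?thesis
    by (simp add: card_cartesian_product divisor_count_def divisor_convolution_def)
qed

lemma card_linear_solutions_diagonal:
  assumes "n > 0"
  shows "card {(a, x, b, y) \<in> linear_solutions n. a = b} + divisor_count n = divisor_sum n"
proof -
  let ?D = "{(a, x, b, y) \<in> linear_solutions n. a = b}"
  let ?S = "SIGMA d:{d. d dvd n}. {1..<d}"
  have "bij_betw (\<lambda>(d, x). (n div d, x, n div d, d - x)) ?S ?D"
  proof (rule bij_betw_byWitness[where f' = "\<lambda>(a, x, b, y). (x + y, x)"])
    have "n div d * x + n div d * (d - x) = n" if "d dvd n" "x < d" for d x
      using that by (simp flip: distrib_left)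
    then show "(\<lambda>(d, x). (n div d, x, n div d, d - x)) ` ?S \<subseteq> ?D"
      using assms by (auto simp: linear_solutions_def dvd_div_eq_0_iff)
  qed (auto simp: linear_solutions_def simp flip: distrib_left)
  then have "card ?D = card ?S" by (rule bij_betw_same_card[symmetric])
  also have "\<dots> = (\<Sum>d | d dvd n. d - 1)" using assms by (subst card_SigmaI) auto
  also have "\<dots> + divisor_count n = (\<Sum>d | d dvd n. d - 1 + 1)"
    unfolding divisor_count_def sum.distrib by simp
  also have "\<dots> = divisor_sum n"
    unfolding divisor_sum_def using assms by (intro sum.cong) (auto intro: dvd_pos_nat)
  finally show ?thesis .
qed

lemma nu_2_divisor_formula:
  assumes "n > 0"
  shows "2 * nu 2 n + divisor_sum n = divisor_convolution n + divisor_count n"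
proof -
  let ?swap = "\<lambda>(a, x, b, y). (b, y, a, x)" and ?key = "\<lambda>(a, x, b, y). b"
  let ?S = "linear_solutions n"
  have "card ?S = 2 * card {t \<in> ?S. ?key t < ?key (?swap t)}
      + card {t \<in> ?S. ?key t = ?key (?swap t)}"
    by (rule card_involution[OF finite_linear_solutions])
      (auto simp: linear_solutions_def add.commute)
  moreover have "{t \<in> ?S. ?key t < ?key (?swap t)} = {(a, x, b, y) \<in> ?S. b < a}"
    "{t \<in> ?S. ?key t = ?key (?swap t)} = {(a, x, b, y) \<in> ?S. a = b}" by auto
  ultimately have "divisor_convolution n = 2 * nu 2 n + card {(a, x, b, y) \<in> ?S. a = b}"
    by (simp add: nu_2_eq_card card_linear_solutions)
  then show ?thesis using card_linear_solutions_diagonal[OF assms] by simp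
qed

section \<open>The congruences\<close>

lemma prime_3_mod_4_dvd_sum_squares:
  fixes q a b :: nat
  assumes q: "prime q" "q mod 4 = 3" and dvd: "q dvd a ^ 2 + b ^ 2"
  shows "q dvd a"
proof (rule ccontr)
  assume a: "\<not> q dvd a"
  then have "\<not> q dvd a ^ 2" using q(1) prime_dvd_power by blast
  then have b: "\<not> q dvd b" using dvd by (auto simp: dvd_add_left_iff power2_eq_square)
  obtain j where j: "q = 4 * j + 3" using q(2) by (metis mult_div_mod_eq)
  then have exp: "q - 1 = 2 * (2 * j + 1)" by simp
  have fermat: "[int c ^ (q - 1) = 1] (mod int q)" if "\<not> q dvd c" for c
    using fermat_theorem[OF q(1) that] by (metis cong_int_iff of_nat_1 of_nat_power)
  have "int q dvd int a ^ 2 + int b ^ 2"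
    using dvd by (metis int_dvd_int_iff of_nat_add of_nat_power)
  then have "[int a ^ 2 = - (int b ^ 2)] (mod int q)" by (simp add: cong_iff_dvd_diff)
  then have "[(int a ^ 2) ^ (2 * j + 1) = (- (int b ^ 2)) ^ (2 * j + 1)] (mod int q)"
    by (rule cong_pow)
  also have "(- (int b ^ 2)) ^ (2 * j + 1) = - (int b ^ (q - 1))"
    unfolding exp power_mult by (rule power_minus_odd) simp
  finally have "[int a ^ (q - 1) = - (int b ^ (q - 1))] (mod int q)"
    unfolding exp power_mult .
  then have "[1 = - 1] (mod int q)"
    using fermat[OF a] fermat[OF b] by (meson cong_minus_minus_iff cong_sym cong_trans)
  then have "int q dvd 2" by (simp add: cong_iff_dvd_diff)
  then show False using j by (auto dest: zdvd_imp_le)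
qed

lemma not_sum_two_squares_if_prime_3_mod_4:
  assumes q: "prime q" "q mod 4 = 3" and "q dvd n" "\<not> q ^ 2 dvd n"
  shows "\<not> is_sum_two_squares n"
proof
  assume "is_sum_two_squares n"
  then obtain a b where n: "n = a ^ 2 + b ^ 2" by (auto simp: is_sum_two_squares_def)
  then have "q dvd a" "q dvd b"
    using prime_3_mod_4_dvd_sum_squares[OF q, of a b] prime_3_mod_4_dvd_sum_squares[OF q, of b a]
      \<open>q dvd n\<close> by (simp_all add: add.commute)
  then have "q ^ 2 dvd n" unfolding n by (intro dvd_add dvd_power_same)
  with \<open>\<not> q ^ 2 dvd n\<close> show False by contradiction
qed

lemma nu_2_cong_0_mod_4:
  fixes q M :: nat
  assumes q: "prime q" "q mod 4 = 3" "\<not> q dvd M" and M: "odd M" "\<not> is_square M"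
  shows "[nu 2 (2 * (q * M)) = 0] (mod 4)"
proof -
  let ?n = "2 * (q * M)"
  have odd_qM: "odd (q * M)" and "4 dvd q + 1" using q(2) M(1) by (auto, presburger+)
  then have "?n > 0" by (simp add: odd_pos)
  have coprime: "coprime q M" "coprime 2 (q * M)"
    using q odd_qM by (simp_all add: prime_imp_coprime)
  have even_M: "even (divisor_count M)" "even (divisor_sum M)"
    using even_divisor_count_iff even_divisor_sum_iff odd_pos M by blast+
  have count_qM: "divisor_count (q * M) = 2 * divisor_count M"
    using coprime(1) q(1) by (simp add: divisor_count_coprime_mult divisor_count_prime)
  have count: "8 dvd divisor_count ?n"
    using even_M(1)
    by (auto simp: divisor_count_coprime_mult[OF coprime(2)] divisor_count_prime count_qM)
  have "4 * 2 dvd 3 * ((q + 1) * divisor_sum M)"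
    by (rule dvd_mult[OF mult_dvd_mono[OF \<open>4 dvd q + 1\<close> even_M(2)]])
  moreover have "divisor_sum ?n = 3 * ((q + 1) * divisor_sum M)"
    using coprime q(1) by (simp add: divisor_sum_coprime_mult divisor_sum_prime)
  ultimately have sum: "8 dvd divisor_sum ?n" by simp
  have "2 < q" using q(2) by presburger
  then have "\<not> q dvd 2 * M" using q by (simp add: prime_dvd_mult_iff nat_dvd_not_less)
  then have "\<not> q ^ 2 dvd ?n"
    using q(1) by (simp add: power2_eq_square mult.left_commute[of 2] prime_gt_0_nat)
  then have "\<not> is_sum_two_squares ?n"
    using q by (intro not_sum_two_squares_if_prime_3_mod_4[of q]) simp_all
  then have "8 dvd divisor_convolution ?n"
    using odd_qM even_M(1) by (intro eight_dvd_divisor_convolution) (auto simp: count_qM)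
  then have "8 dvd 2 * nu 2 ?n + divisor_sum ?n"
    using nu_2_divisor_formula[OF \<open>?n > 0\<close>] count by simp
  then have "2 * 4 dvd 2 * nu 2 ?n" using sum by (simp add: dvd_add_left_iff)
  then show ?thesis by (simp add: cong_0_iff)
qed

lemma not_is_square_if_mod_3_4_7:
  fixes n :: nat
  assumes "n mod 3 = 2 \<or> n mod 4 = 3 \<or> n mod 7 = 5"
  shows "\<not> is_square n"
proof -
  consider (mod_3) "n mod 3 = 2" | (mod_4) "n mod 4 = 3" | (mod_7) "n mod 7 = 5"
    using assms by blast
  then show ?thesis
  proof cases
    case mod_3
    then show ?thesis
      by (intro not_is_square_if_mod[of 3]) (simp_all add: atLeastLessThan_nat_numeral)
  next
    case mod_4
    then show ?thesis
      by (intro not_is_square_if_mod[of 4]) (simp_all add: atLeastLessThan_nat_numeral)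
  next
    case mod_7
    then show ?thesis
      by (intro not_is_square_if_mod[of 7]) (simp_all add: atLeastLessThan_nat_numeral)
  qed
qed

lemma progression_eq_double_prime_mult:
  fixes A B n :: nat
  assumes "(A, B) \<in> {(36, 30), (72, 42), (196, 70), (252, 114)}"
  obtains q M where "A * n + B = 2 * (q * M)" "q \<in> {3, 7}" "\<not> q dvd M" "odd M" "\<not> is_square M"
proof -
  consider (A_36) "A = 36" "B = 30" | (A_72) "A = 72" "B = 42"
    | (A_196) "A = 196" "B = 70" | (A_252) "A = 252" "B = 114"
    using assms by auto
  then show thesis
  proof cases
    case A_36
    have "(6 * n + 5) mod 3 = 2" "\<not> 3 dvd 6 * n + 5" "odd (6 * n + 5)" by presburger+
    then show thesis
      using A_36 by (intro that[of 3 "6 * n + 5"] not_is_square_if_mod_3_4_7) simp_all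
  next
    case A_72
    have "(12 * n + 7) mod 4 = 3" "\<not> 3 dvd 12 * n + 7" "odd (12 * n + 7)" by presburger+
    then show thesis
      using A_72 by (intro that[of 3 "12 * n + 7"] not_is_square_if_mod_3_4_7) simp_all
  next
    case A_196
    have "(14 * n + 5) mod 7 = 5" "\<not> 7 dvd 14 * n + 5" "odd (14 * n + 5)" by presburger+
    then show thesis
      using A_196 by (intro that[of 7 "14 * n + 5"] not_is_square_if_mod_3_4_7) simp_all
  next
    case A_252
    have "(42 * n + 19) mod 7 = 5" "\<not> 3 dvd 42 * n + 19" "odd (42 * n + 19)" by presburger+
    then show thesis
      using A_252 by (intro that[of 3 "42 * n + 19"] not_is_square_if_mod_3_4_7) simp_all
  qed
qed

theorem theorem1:
  fixes A B n :: nat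
  assumes "(A, B) \<in> {(36, 30), (72, 42), (196, 70), (252, 114)}"
  shows "[nu 2 (A * n + B) = 0] (mod 4)"
proof -
  obtain q M where factors: "A * n + B = 2 * (q * M)" and q: "q \<in> {3, 7}"
    and M: "\<not> q dvd M" "odd M" "\<not> is_square M"
    using assms by (rule progression_eq_double_prime_mult)
  have "prime q" "q mod 4 = 3" using q by auto
  then show ?thesis unfolding factors using M by (rule nu_2_cong_0_mod_4)
qed

end
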